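(* Let $(X,d)$ be a locally compact length space. Then there exists a metric $d_\Omega$ conformally related to $d$, i.e. there is a continuous function $\Omega\colon X\to(0,+\infty)$ with associated conformal length metric $d_\Omega$, such that the metric space $(X,d_\Omega)$ is Cauchy-complete.
   Context: Let $(X,d)$ be a metric space (with finite-valued $d$). Paths are maps $\gamma\colon[a,b]\to X$ continuous with respect to $d$. The variational length is $L^d(\gamma):=\sup\{\sum_{i=0}^{m-1}d(\gamma(t_i),\gamma(t_{i+1})):a=t_0<\dots<t_m=b\}$. $(X,d)$ is a length space if $d(x,y)=\inf\{L^d(\gamma):\gamma\text{ a path from }x\text{ to }y\}$ for all $x,y\in X$. For a continuous $\Omega\colon X\to(0,+\infty)$ the conformal length of a path $\gamma\colon[a,b]\to X$ is $$L_\Omega^d(\gamma):=\sup\Big\{\sum_{i=0}^{m-1}\min_{t\in[t_i,t_{i+1}]}\Omega(\gamma(t))\,d(\gamma(t_i),\gamma(t_{i+1}))\ :\ a=t_0<\dots<t_m=b\Big\},$$ and the conformal length metric is $d_\Omega(x,y):=\inf\{L_\Omega^d(\gamma):\gamma\text{ a path from }x\text{ to }y\}$. *)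

theory Defs
  imports "HOL-Analysis.Analysis"
begin

definition metric_path ::
    "'a set \<Rightarrow> ('a \<Rightarrow> 'a \<Rightarrow> real) \<Rightarrow> 'a \<Rightarrow> 'a \<Rightarrow> real \<Rightarrow> real \<Rightarrow> (real \<Rightarrow> 'a) \<Rightarrow> bool" where
  "metric_path M d x y a b \<gamma> \<longleftrightarrow>
     a \<le> b \<and> continuous_map (top_of_set {a..b}) (Metric_space.mtopology M d) \<gamma> \<and>
     \<gamma> a = x \<and> \<gamma> b = y"

text \<open>Only the values \<open>t 0, \<dots>, t m\<close> matter.\<close>

definition partition_of :: "real \<Rightarrow> real \<Rightarrow> nat \<Rightarrow> (nat \<Rightarrow> real) \<Rightarrow> bool" where
  "partition_of a b m t \<longleftrightarrow> t 0 = a \<and> t m = b \<and> (\<forall>i<m. t i < t (Suc i))"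

text \<open>Lengths and infima of lengths are taken in \<^typ>\<open>ennreal\<close>, so that a non-rectifiable
  path has length \<open>\<infinity>\<close> and an infimum over no paths is \<open>\<infinity>\<close>.\<close>

definition variational_length ::
    "('a \<Rightarrow> 'a \<Rightarrow> real) \<Rightarrow> real \<Rightarrow> real \<Rightarrow> (real \<Rightarrow> 'a) \<Rightarrow> ennreal" where
  "variational_length d a b \<gamma> =
     Sup {ennreal (\<Sum>i<m. d (\<gamma> (t i)) (\<gamma> (t (Suc i)))) | m t. partition_of a b m t}"

definition length_space :: "'a set \<Rightarrow> ('a \<Rightarrow> 'a \<Rightarrow> real) \<Rightarrow> bool" where
  "length_space M d \<longleftrightarrow> Metric_space M d \<and>
     (\<forall>x\<in>M. \<forall>y\<in>M. ennreal (d x y) =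
        Inf {variational_length d a b \<gamma> | a b \<gamma>. metric_path M d x y a b \<gamma>})"

text \<open>For continuous \<open>\<Omega>\<close> and \<open>\<gamma>\<close>, the infimum over the compact interval \<open>[t i, t (i+1)]\<close> below
  is attained, i.e. it is the minimum.\<close>

definition conformal_length ::
    "('a \<Rightarrow> 'a \<Rightarrow> real) \<Rightarrow> ('a \<Rightarrow> real) \<Rightarrow> real \<Rightarrow> real \<Rightarrow> (real \<Rightarrow> 'a) \<Rightarrow> ennreal" where
  "conformal_length d \<Omega> a b \<gamma> =
     Sup {ennreal (\<Sum>i<m. (INF s\<in>{t i..t (Suc i)}. \<Omega> (\<gamma> s)) * d (\<gamma> (t i)) (\<gamma> (t (Suc i)))) | m t.
          partition_of a b m t}"

definition conformal_dist ::
    "'a set \<Rightarrow> ('a \<Rightarrow> 'a \<Rightarrow> real) \<Rightarrow> ('a \<Rightarrow> real) \<Rightarrow> 'a \<Rightarrow> 'a \<Rightarrow> ennreal" where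
  "conformal_dist M d \<Omega> x y =
     Inf {conformal_length d \<Omega> a b \<gamma> | a b \<gamma>. metric_path M d x y a b \<gamma>}"

end

theory Submission
  imports Defs
begin

text \<open>
  The conformal factor is \<open>\<Omega> = 1 / r\<close>, where \<open>r x\<close> is the radius of compactness of \<open>x\<close>: the
  supremum of the \<open>\<rho> \<le> 1\<close> for which the closed ball of radius \<open>\<rho>\<close> about \<open>x\<close> is compact.  Local
  compactness makes \<open>r\<close> positive, and the triangle inequality makes it 1-Lipschitz, so \<open>\<Omega>\<close> is
  continuous.  It is a variant of the quasihyperbolic metric of a domain, with \<open>r\<close> in the role of
  the distance to the boundary: any place where compactness is about to fail is pushed infinitely
  far away.

  Completeness comes from a scale-invariant estimate.  A path that starts at \<open>x\<close> and leaves the ball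
  of radius \<open>r x / 2\<close> does so through points where \<open>r \<le> 3/2 * r x\<close>, hence where
  \<open>\<Omega> \<ge> 2 / (3 * r x)\<close>.  Up to its first exit it already has conformal length at least
  \<open>2 / (3 * r x) * (r x / 2) = 1/3\<close> (\<open>conformal_length_escape\<close>).  The bound does not depend
  on \<open>x\<close>, so every \<open>d\<^sub>\<Omega>\<close>-ball of radius \<open>1/3\<close> lies in a \<open>d\<close>-compact ball.  A Cauchy
  sequence for \<open>d\<^sub>\<Omega>\<close> is eventually in such a ball and has a \<open>d\<close>-convergent subsequence.

  It remains to turn \<open>d\<close>-convergence into \<open>d\<^sub>\<Omega>\<close>-convergence, and here the length space
  hypothesis enters: nearby points are joined by \<open>d\<close>-short paths, these stay where \<open>\<Omega>\<close> is
  bounded, and there conformal length is at most a constant times variational length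
  (\<open>conformal_dist_local_upper\<close>).  The same comparison along one rectifiable path shows that
  \<open>d\<^sub>\<Omega>\<close> is finite.  Since \<open>r \<le> 1\<close>, we have \<open>\<Omega> \<ge> 1\<close> and therefore \<open>d\<^sub>\<Omega> \<ge> d\<close>, which
  separates points; symmetry and the triangle inequality follow from reversing and joining paths.
\<close>

section \<open>Weak partitions\<close>

text \<open>Partitions are strictly increasing, but cutting, reversing or joining them produces repeated
  points.  If degenerate intervals contribute nothing, the repetitions can be dropped without
  changing the sum.\<close>

lemma weak_partition_sum:
  fixes F :: "real \<Rightarrow> real \<Rightarrow> real" and t :: "nat \<Rightarrow> real"
  assumes "\<And>i. i < m \<Longrightarrow> t i \<le> t (Suc i)" and "\<And>i. i \<le> m \<Longrightarrow> F (t i) (t i) = 0"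
  shows "\<exists>k s. partition_of (t 0) (t m) k s \<and> (\<Sum>i<k. F (s i) (s (Suc i))) = (\<Sum>i<m. F (t i) (t (Suc i)))"
  using assms
proof (induction m)
  case 0
  show ?case
    by (rule exI[of _ 0], rule exI[of _ t]) (simp add: partition_of_def)
next
  case (Suc m)
  obtain k s where s: "partition_of (t 0) (t m) k s"
    and eq: "(\<Sum>i<k. F (s i) (s (Suc i))) = (\<Sum>i<m. F (t i) (t (Suc i)))"
    using Suc.IH Suc.prems by (meson less_Suc_eq le_Suc_eq)
  show ?case
  proof (cases "t m = t (Suc m)")
    case True
    then have "F (t m) (t (Suc m)) = 0" using Suc.prems(2)[of m] by simp
    then show ?thesis using s eq True by auto
  next
    case False
    then have lt: "t m < t (Suc m)" using Suc.prems(1)[of m] by simp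
    define s' where "s' = s(Suc k := t (Suc m))"
    have old: "s' i = s i" if "i \<le> k" for i using that by (simp add: s'_def)
    have "partition_of (t 0) (t (Suc m)) (Suc k) s'"
      using s lt old unfolding partition_of_def by (auto simp: s'_def less_Suc_eq)
    moreover have "(\<Sum>i<k. F (s' i) (s' (Suc i))) = (\<Sum>i<k. F (s i) (s (Suc i)))"
      by (rule sum.cong) (auto simp: old)
    moreover have "s' k = t m" "s' (Suc k) = t (Suc m)"
      using s by (auto simp: s'_def partition_of_def)
    ultimately show ?thesis using eq by (intro exI[of _ "Suc k"] exI[of _ s']) simp
  qed
qed

lemma chain_mono:
  fixes t :: "nat \<Rightarrow> real"
  assumes "\<And>i. i < m \<Longrightarrow> t i \<le> t (Suc i)" "i \<le> j" "j \<le> m"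
  shows "t i \<le> t j"
  using assms(2,3)
proof (induction rule: dec_induct)
  case (step n) then show ?case using assms(1)[of n] by simp
qed simp

section \<open>Conformal length\<close>

definition conformal_chord ::
    "('a \<Rightarrow> 'a \<Rightarrow> real) \<Rightarrow> ('a \<Rightarrow> real) \<Rightarrow> (real \<Rightarrow> 'a) \<Rightarrow> real \<Rightarrow> real \<Rightarrow> real" where
  "conformal_chord d \<Omega> \<gamma> s u = (INF v\<in>{s..u}. \<Omega> (\<gamma> v)) * d (\<gamma> s) (\<gamma> u)"

lemma conformal_length_chords:
  "conformal_length d \<Omega> a b \<gamma> =
     Sup {ennreal (\<Sum>i<m. conformal_chord d \<Omega> \<gamma> (t i) (t (Suc i))) | m t. partition_of a b m t}"
  by (simp add: conformal_length_def conformal_chord_def)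

lemma variational_length_eq_conformal_length:
  "variational_length d a b \<gamma> = conformal_length d (\<lambda>_. 1) a b \<gamma>"
proof -
  have "(\<Sum>i<m. (INF v\<in>{t i..t (Suc i)}. 1) * d (\<gamma> (t i)) (\<gamma> (t (Suc i)))) =
      (\<Sum>i<m. d (\<gamma> (t i)) (\<gamma> (t (Suc i))))" if "partition_of a b m t" for m t
    using that by (intro sum.cong) (auto simp: partition_of_def less_imp_le)
  then show ?thesis
    unfolding variational_length_def conformal_length_def
    by (intro arg_cong[where f = Sup] Collect_cong ex_cong1) auto
qed

lemma conformal_length_le:
  assumes "\<And>m t. partition_of a b m t \<Longrightarrow>
             ennreal (\<Sum>i<m. conformal_chord d \<Omega> \<gamma> (t i) (t (Suc i))) \<le> L"
  shows "conformal_length d \<Omega> a b \<gamma> \<le> L"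
  unfolding conformal_length_chords using assms by (auto intro!: Sup_least)

text \<open>The interface to conformal length from below: test sequences need not increase strictly.
  The last assumption stands for the curve lying in the space, outside of which
  \<open>d\<close> may fail to vanish on the diagonal.\<close>

lemma chord_sum_le_conformal_length:
  assumes "t 0 = a" "t m = b" "\<And>i. i < m \<Longrightarrow> t i \<le> t (Suc i)"
    and "\<And>s. s \<in> {a..b} \<Longrightarrow> d (\<gamma> s) (\<gamma> s) = 0"
  shows "ennreal (\<Sum>i<m. conformal_chord d \<Omega> \<gamma> (t i) (t (Suc i))) \<le> conformal_length d \<Omega> a b \<gamma>"
proof -
  have "t i \<in> {a..b}" if "i \<le> m" for i
    using chain_mono[of m t 0 i] chain_mono[of m t i m] assms(1-3) that by auto
  then have "conformal_chord d \<Omega> \<gamma> (t i) (t i) = 0" if "i \<le> m" for i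
    using assms(4) that by (simp add: conformal_chord_def)
  with weak_partition_sum[of m t "conformal_chord d \<Omega> \<gamma>"] assms(1-3)
  obtain k s where "partition_of a b k s"
    "(\<Sum>i<k. conformal_chord d \<Omega> \<gamma> (s i) (s (Suc i))) = (\<Sum>i<m. conformal_chord d \<Omega> \<gamma> (t i) (t (Suc i)))"
    by auto
  then show ?thesis
    unfolding conformal_length_chords by (intro Sup_upper) (metis (mono_tags, lifting) mem_Collect_eq)
qed

lemma two_chords_le_conformal_length:
  assumes "a \<le> c" "c \<le> b" "\<And>s. s \<in> {a..b} \<Longrightarrow> d (\<gamma> s) (\<gamma> s) = 0"
  shows "ennreal (conformal_chord d \<Omega> \<gamma> a c + conformal_chord d \<Omega> \<gamma> c b) \<le> conformal_length d \<Omega> a b \<gamma>"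
  using chord_sum_le_conformal_length[of "\<lambda>i. if i = 0 then a else if i = 1 then c else b" a 2 b d \<gamma> \<Omega>] assms
  by (simp add: numeral_2_eq_2 less_Suc_eq)

lemma partition_of_mono:
  assumes "partition_of a b m t" "i \<le> j" "j \<le> m" shows "t i \<le> t j"
  using assms chain_mono[of m t i j] by (auto simp: partition_of_def less_imp_le)

lemma partition_of_bounds:
  assumes "partition_of a b m t" "i \<le> m"
  shows "a \<le> t i" "t i \<le> b"
  using partition_of_mono[OF assms(1), of 0 i] partition_of_mono[OF assms(1), of i m] assms
  by (auto simp: partition_of_def)

lemma conformal_chord_reverse:
  assumes "\<And>x y. d x y = d y x"
  shows "conformal_chord d \<Omega> (\<lambda>s. \<gamma> (c - s)) s u = conformal_chord d \<Omega> \<gamma> (c - u) (c - s)"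
proof -
  have "(\<lambda>v. \<Omega> (\<gamma> (c - v))) ` {s..u} = (\<lambda>v. \<Omega> (\<gamma> v)) ` ((-) c ` {s..u})" by (simp only: image_image)
  then show ?thesis by (simp add: conformal_chord_def assms)
qed

lemma conformal_length_reverse_le:
  assumes "\<And>x y. d x y = d y x" "\<And>s. s \<in> {a..b} \<Longrightarrow> d (\<gamma> s) (\<gamma> s) = 0"
  shows "conformal_length d \<Omega> a b (\<lambda>s. \<gamma> (a + b - s)) \<le> conformal_length d \<Omega> a b \<gamma>"
proof (rule conformal_length_le)
  fix m t assume t: "partition_of a b m t"
  define t' where "t' = (\<lambda>i. a + b - t (m - i))"
  have "(\<Sum>i<m. conformal_chord d \<Omega> (\<lambda>s. \<gamma> (a + b - s)) (t i) (t (Suc i))) =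
      (\<Sum>i<m. conformal_chord d \<Omega> \<gamma> (a + b - t (Suc i)) (a + b - t i))"
    using conformal_chord_reverse[OF assms(1), where c = "a + b" and \<gamma> = \<gamma>] by (intro sum.cong) auto
  also have "\<dots> = (\<Sum>i<m. conformal_chord d \<Omega> \<gamma> (a + b - t (Suc (m - Suc i))) (a + b - t (m - Suc i)))"
    by (rule sum.nat_diff_reindex[symmetric])
  also have "\<dots> = (\<Sum>i<m. conformal_chord d \<Omega> \<gamma> (t' i) (t' (Suc i)))"
    by (rule sum.cong) (auto simp: t'_def Suc_diff_Suc)
  also have "ennreal \<dots> \<le> conformal_length d \<Omega> a b \<gamma>"
    using t assms(2) partition_of_mono[OF t]
    by (intro chord_sum_le_conformal_length) (auto simp: t'_def partition_of_def)
  finally show "ennreal (\<Sum>i<m. conformal_chord d \<Omega> (\<lambda>s. \<gamma> (a + b - s)) (t i) (t (Suc i)))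
      \<le> conformal_length d \<Omega> a b \<gamma>" .
qed

lemma conformal_chord_shift:
  "conformal_chord d \<Omega> (\<lambda>s. \<gamma> (s + c)) s u = conformal_chord d \<Omega> \<gamma> (s + c) (u + c)"
proof -
  have "(\<lambda>v. \<Omega> (\<gamma> (v + c))) ` {s..u} = (\<lambda>v. \<Omega> (\<gamma> v)) ` ((\<lambda>v. v + c) ` {s..u})"
    by (simp only: image_image)
  then show ?thesis by (simp add: conformal_chord_def)
qed

lemma conformal_chord_cong:
  assumes "\<And>v. v \<in> {s..u} \<Longrightarrow> \<gamma> v = \<delta> v" "s \<le> u"
  shows "conformal_chord d \<Omega> \<gamma> s u = conformal_chord d \<Omega> \<delta> s u"
proof -
  have "(\<lambda>v. \<Omega> (\<gamma> v)) ` {s..u} = (\<lambda>v. \<Omega> (\<delta> v)) ` {s..u}" using assms by (intro image_cong) auto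
  then show ?thesis using assms by (simp add: conformal_chord_def)
qed

context Metric_space
begin

lemma metric_path_in_space:
  assumes "metric_path M d x y a b \<gamma>" "s \<in> {a..b}" shows "\<gamma> s \<in> M"
  using assms continuous_map_image_subset_topspace[of "top_of_set {a..b}" mtopology \<gamma>]
  by (auto simp: metric_path_def)

lemma metric_path_ends:
  assumes "metric_path M d x y a b \<gamma>" 
  shows "a \<le> b" "\<gamma> a = x" "\<gamma> b = y" "x \<in> M" "y \<in> M"
  using assms metric_path_in_space[OF assms, of a] metric_path_in_space[OF assms, of b] by (auto simp: metric_path_def)

text \<open>Refining a partition can only increase the sum: the distances obey the triangle
  inequality, and the infimum of \<open>\<Omega>\<close> grows when the interval shrinks.\<close>

lemma conformal_chord_triangle:
  assumes "\<And>v. v \<in> {s..u} \<Longrightarrow> \<gamma> v \<in> M" "\<And>x. x \<in> M \<Longrightarrow> 0 \<le> \<Omega> x" "s \<le> c" "c \<le> u"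
  shows "conformal_chord d \<Omega> \<gamma> s u \<le> conformal_chord d \<Omega> \<gamma> s c + conformal_chord d \<Omega> \<gamma> c u"
proof -
  let ?I = "\<lambda>s u. INF v\<in>{s..u}. \<Omega> (\<gamma> v)"
  have bdd: "bdd_below ((\<lambda>v. \<Omega> (\<gamma> v)) ` {s..u})"
    using assms(1,2) by (intro bdd_belowI[of _ 0]) auto
  have "0 \<le> ?I s u" using assms by (intro cINF_greatest) auto
  then have "?I s u * d (\<gamma> s) (\<gamma> u) \<le> ?I s u * (d (\<gamma> s) (\<gamma> c) + d (\<gamma> c) (\<gamma> u))"
    using assms by (intro mult_left_mono triangle) auto
  also have "\<dots> \<le> ?I s c * d (\<gamma> s) (\<gamma> c) + ?I c u * d (\<gamma> c) (\<gamma> u)"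
    unfolding distrib_left using assms bdd
    by (intro add_mono mult_right_mono cINF_superset_mono) auto
  finally show ?thesis by (simp add: conformal_chord_def)
qed

lemma conformal_chord_nonneg:
  assumes "\<And>v. v \<in> {s..u} \<Longrightarrow> \<gamma> v \<in> M" "\<And>x. x \<in> M \<Longrightarrow> 0 \<le> \<Omega> x" "s \<le> u"
  shows "0 \<le> conformal_chord d \<Omega> \<gamma> s u"
  unfolding conformal_chord_def using assms by (intro mult_nonneg_nonneg cINF_greatest) auto

text \<open>The second path is shifted in time to start when the first one ends.  A partition of the
  joint interval need not contain the junction \<open>b\<close>; truncating its points by \<open>min _ b\<close> and
  \<open>max _ b\<close> yields weak partitions of the two halves, and subadditivity of the chords pays for
  the one interval that straddles \<open>b\<close>.\<close>

lemma conformal_length_join: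
  assumes g1: "metric_path M d x y a b \<gamma>" and g2: "metric_path M d y z a' b' \<delta>"
    and pos: "\<And>x. x \<in> M \<Longrightarrow> 0 \<le> \<Omega> x"
  defines "\<eta> \<equiv> \<lambda>s. if s \<le> b then \<gamma> s else \<delta> (s + (a' - b))"
  shows "metric_path M d x z a (b + (b' - a')) \<eta>"
    and "conformal_length d \<Omega> a (b + (b' - a')) \<eta> \<le> conformal_length d \<Omega> a b \<gamma> + conformal_length d \<Omega> a' b' \<delta>"
proof -
  let ?c = "b + (b' - a')"
  note e1 = metric_path_ends[OF g1] and e2 = metric_path_ends[OF g2]
  have cont1: "continuous_map (top_of_set {a..b}) mtopology \<gamma>"
   and cont2: "continuous_map (top_of_set {a'..b'}) mtopology \<delta>"
    using g1 g2 by (auto simp: metric_path_def)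
  have "continuous_map (top_of_set {b..?c}) mtopology (\<delta> \<circ> (\<lambda>s. s + (a' - b)))"
    by (rule continuous_map_compose[OF _ cont2]) (auto intro!: continuous_intros)
  then have shift: "continuous_map (top_of_set {b..?c}) mtopology (\<lambda>s. \<delta> (s + (a' - b)))"
    by (simp add: o_def)
  have sub1: "subtopology (top_of_set {a..?c}) {s \<in> topspace (top_of_set {a..?c}). s \<le> b} = top_of_set {a..b}"
    using e1 e2 by (subst subtopology_subtopology, intro arg_cong[where f = "subtopology euclidean"]) auto
  have sub2: "subtopology (top_of_set {a..?c}) {s \<in> topspace (top_of_set {a..?c}). b \<le> s} = top_of_set {b..?c}"
    using e1 e2 by (subst subtopology_subtopology, intro arg_cong[where f = "subtopology euclidean"]) auto
  have "continuous_map (top_of_set {a..?c}) mtopology \<eta>"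
    unfolding \<eta>_def
    by (rule continuous_map_cases_le; (unfold sub1 sub2)?) (use cont1 shift e1 e2 in auto)
  then show path: "metric_path M d x z a ?c \<eta>"
    using e1 e2 unfolding metric_path_def \<eta>_def by auto
  have late: "\<eta> s = \<delta> (s + (a' - b))" if "b \<le> s" for s
    using that e1 e2 by (cases "s = b") (auto simp: \<eta>_def)
  show "conformal_length d \<Omega> a ?c \<eta> \<le> conformal_length d \<Omega> a b \<gamma> + conformal_length d \<Omega> a' b' \<delta>"
  proof (rule conformal_length_le)
    fix m t assume t: "partition_of a ?c m t"
    define p where "p i = min (t i) b" for i
    define q where "q i = max (t i) b + (a' - b)" for i
    have chord: "conformal_chord d \<Omega> \<eta> (t i) (t (Suc i))
        \<le> conformal_chord d \<Omega> \<gamma> (p i) (p (Suc i)) + conformal_chord d \<Omega> \<delta> (q i) (q (Suc i))"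
      if "i < m" for i
    proof -
      have le: "t i \<le> t (Suc i)" using t that by (auto simp: partition_of_def less_imp_le)
      have bd: "a \<le> t i" "t (Suc i) \<le> ?c" using partition_of_bounds[OF t] that by auto
      have \<eta>M: "\<eta> v \<in> M" if "v \<in> {a..?c}" for v using metric_path_in_space[OF path that] .
      have "conformal_chord d \<Omega> \<eta> (min (t i) b) (min (t (Suc i)) b) = conformal_chord d \<Omega> \<gamma> (p i) (p (Suc i))"
        unfolding p_def using le by (intro conformal_chord_cong) (auto simp: \<eta>_def)
      moreover have "conformal_chord d \<Omega> \<eta> (max (t i) b) (max (t (Suc i)) b) = conformal_chord d \<Omega> \<delta> (q i) (q (Suc i))"
        unfolding q_def conformal_chord_shift[symmetric] using le
        by (intro conformal_chord_cong late) auto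
      moreover have "conformal_chord d \<Omega> \<eta> (t i) (t (Suc i)) \<le>
          conformal_chord d \<Omega> \<eta> (min (t i) b) (min (t (Suc i)) b) + conformal_chord d \<Omega> \<eta> (max (t i) b) (max (t (Suc i)) b)"
      proof -
        have z: "conformal_chord d \<Omega> \<eta> b b = 0"
          using \<eta>M[of b] e1 e2 by (simp add: conformal_chord_def)
        \<comment> \<open>Only the straddling interval needs subadditivity; for any other one of the two
          truncated intervals degenerates to the point \<open>b\<close>.\<close>
        consider "t (Suc i) \<le> b" | "b \<le> t i" | "t i \<le> b" "b \<le> t (Suc i)" by linarith
        then show ?thesis
        proof cases
          case 3
          then show ?thesis
            using conformal_chord_triangle[of "t i" "t (Suc i)" \<eta> \<Omega> b] \<eta>M pos bd by (auto simp: min_def max_def)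
        qed (use le z in \<open>auto simp: min_absorb1 max_absorb1 max_absorb2 min_absorb2\<close>)
      qed
      ultimately show ?thesis by simp
    qed
    have p: "ennreal (\<Sum>i<m. conformal_chord d \<Omega> \<gamma> (p i) (p (Suc i))) \<le> conformal_length d \<Omega> a b \<gamma>"
      using t e1 e2 metric_path_in_space[OF g1]
      by (intro chord_sum_le_conformal_length)
        (auto simp: p_def partition_of_def min_def less_imp_le intro: order_trans less_imp_le)
    have q: "ennreal (\<Sum>i<m. conformal_chord d \<Omega> \<delta> (q i) (q (Suc i))) \<le> conformal_length d \<Omega> a' b' \<delta>"
      using t e1 e2 metric_path_in_space[OF g2]
      by (intro chord_sum_le_conformal_length)
        (auto simp: q_def partition_of_def max_def less_imp_le intro: order_trans less_imp_le)
    have range: "a \<le> p i \<and> p i \<le> p (Suc i) \<and> p (Suc i) \<le> b \<and> a' \<le> q i \<and> q i \<le> q (Suc i) \<and> q (Suc i) \<le> b'" if "i < m" for i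
      using partition_of_bounds[OF t, of i] partition_of_bounds[OF t, of "Suc i"] partition_of_mono[OF t, of i "Suc i"] that e1 e2
      by (auto simp: p_def q_def)
    have nn: "0 \<le> (\<Sum>i<m. conformal_chord d \<Omega> \<gamma> (p i) (p (Suc i)))" "0 \<le> (\<Sum>i<m. conformal_chord d \<Omega> \<delta> (q i) (q (Suc i)))"
      using range pos metric_path_in_space[OF g1] metric_path_in_space[OF g2]
      by (force intro!: sum_nonneg conformal_chord_nonneg)+
    have "ennreal (\<Sum>i<m. conformal_chord d \<Omega> \<eta> (t i) (t (Suc i)))
      \<le> ennreal ((\<Sum>i<m. conformal_chord d \<Omega> \<gamma> (p i) (p (Suc i))) + (\<Sum>i<m. conformal_chord d \<Omega> \<delta> (q i) (q (Suc i))))"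
      unfolding sum.distrib[symmetric] using chord by (intro ennreal_leI sum_mono) auto
    also have "\<dots> \<le> conformal_length d \<Omega> a b \<gamma> + conformal_length d \<Omega> a' b' \<delta>"
      using nn p q by (simp add: ennreal_plus add_mono)
    finally show "ennreal (\<Sum>i<m. conformal_chord d \<Omega> \<eta> (t i) (t (Suc i)))
      \<le> conformal_length d \<Omega> a b \<gamma> + conformal_length d \<Omega> a' b' \<delta>" .
  qed
qed

end

section \<open>The conformal length metric\<close>

lemma Inf_add_Inf_ennreal_ge:
  fixes A B :: "ennreal set"
  assumes "\<And>p q. p \<in> A \<Longrightarrow> q \<in> B \<Longrightarrow> c \<le> p + q"
  shows "c \<le> Inf A + Inf B"
proof (rule ennreal_le_epsilon)
  fix e :: real
  assume fin: "Inf A + Inf B < top" and "0 < e"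
  then have e: "0 < ennreal (e/2)" by simp
  have "Inf A \<noteq> \<infinity>" "Inf B \<noteq> \<infinity>"
    using fin by (metis ennreal_add_less_top infinity_ennreal_def less_irrefl)+
  then have "Inf A < Inf A + ennreal (e/2)" "Inf B < Inf B + ennreal (e/2)"
    using e by (metis ennreal_add_left_cancel_less add_0_right)+
  then obtain p q where "p \<in> A" "p < Inf A + ennreal (e/2)" "q \<in> B" "q < Inf B + ennreal (e/2)"
    by (meson Inf_less_iff)
  then have "c \<le> (Inf A + ennreal (e/2)) + (Inf B + ennreal (e/2))"
    using assms[of p q] by (meson add_mono less_imp_le order_trans)
  also have "\<dots> = Inf A + Inf B + (ennreal (e/2) + ennreal (e/2))" by (simp add: ac_simps)
  also have "ennreal (e/2) + ennreal (e/2) = ennreal e" using \<open>0 < e\<close> by (simp flip: ennreal_plus)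
  finally show "c \<le> Inf A + Inf B + ennreal e" .
qed

context Metric_space
begin

lemma conformal_dist_le:
  "metric_path M d x y a b \<gamma> \<Longrightarrow> conformal_dist M d \<Omega> x y \<le> conformal_length d \<Omega> a b \<gamma>"
  unfolding conformal_dist_def by (rule Inf_lower) blast

lemma conformal_dist_triangle:
  assumes "\<And>x. x \<in> M \<Longrightarrow> 0 \<le> \<Omega> x"
  shows "conformal_dist M d \<Omega> x z \<le> conformal_dist M d \<Omega> x y + conformal_dist M d \<Omega> y z"
proof -
  have *: "conformal_dist M d \<Omega> x z \<le> conformal_length d \<Omega> a b \<gamma> + conformal_length d \<Omega> a' b' \<delta>"
    if "metric_path M d x y a b \<gamma>" "metric_path M d y z a' b' \<delta>" for a b \<gamma> a' b' \<delta>
    using conformal_dist_le[OF conformal_length_join(1)[OF that assms]]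
      conformal_length_join(2)[OF that assms] by (rule order_trans)
  show ?thesis
    unfolding conformal_dist_def[of M d \<Omega> x y] conformal_dist_def[of M d \<Omega> y z]
    by (rule Inf_add_Inf_ennreal_ge) (use * in blast)
qed

lemma conformal_dist_commute: "conformal_dist M d \<Omega> x y = conformal_dist M d \<Omega> y x"
proof -
  have "conformal_dist M d \<Omega> x y \<le> conformal_dist M d \<Omega> y x" for x y
    unfolding conformal_dist_def[of M d \<Omega> y x]
  proof (rule Inf_greatest, clarify)
    fix a b \<gamma> assume g: "metric_path M d y x a b \<gamma>"
    have "continuous_map (top_of_set {a..b}) mtopology (\<gamma> \<circ> (\<lambda>s. a + b - s))"
      using g unfolding metric_path_def
      by (intro continuous_map_compose[where X' = "top_of_set {a..b}"]) (auto intro!: continuous_intros)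
    then have "metric_path M d x y a b (\<lambda>s. \<gamma> (a + b - s))"
      using g by (simp add: metric_path_def o_def)
    then have "conformal_dist M d \<Omega> x y \<le> conformal_length d \<Omega> a b (\<lambda>s. \<gamma> (a + b - s))"
      by (rule conformal_dist_le)
    also have "\<dots> \<le> conformal_length d \<Omega> a b \<gamma>"
      using metric_path_in_space[OF g] by (intro conformal_length_reverse_le commute) auto
    finally show "conformal_dist M d \<Omega> x y \<le> conformal_length d \<Omega> a b \<gamma>" .
  qed
  then show ?thesis by (intro antisym)
qed

lemma conformal_length_le_variational_length:
  assumes g: "metric_path M d x y a b \<gamma>" and "\<And>x. x \<in> M \<Longrightarrow> 0 \<le> \<Omega> x"
    and K: "\<And>s. s \<in> {a..b} \<Longrightarrow> \<Omega> (\<gamma> s) \<le> K"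
  shows "conformal_length d \<Omega> a b \<gamma> \<le> ennreal K * variational_length d a b \<gamma>"
proof (rule conformal_length_le)
  fix m t assume t: "partition_of a b m t"
  have "0 \<le> K" using K[of a] metric_path_ends[OF g] assms(2)[of x] by auto
  have "conformal_chord d \<Omega> \<gamma> (t i) (t (Suc i)) \<le> K * d (\<gamma> (t i)) (\<gamma> (t (Suc i)))" if "i < m" for i
  proof -
    have b: "a \<le> t i" "t i \<le> t (Suc i)" "t (Suc i) \<le> b"
      using partition_of_bounds[OF t] partition_of_mono[OF t, of i "Suc i"] that by auto
    have "(INF v\<in>{t i..t (Suc i)}. \<Omega> (\<gamma> v)) \<le> \<Omega> (\<gamma> (t i))"
      using b metric_path_in_space[OF g] assms(2)
      by (intro cINF_lower bdd_belowI[of _ 0]) auto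
    also have "\<dots> \<le> K" using K b by auto
    finally show ?thesis unfolding conformal_chord_def by (intro mult_right_mono) auto
  qed
  then have "ennreal (\<Sum>i<m. conformal_chord d \<Omega> \<gamma> (t i) (t (Suc i))) \<le> ennreal (K * (\<Sum>i<m. d (\<gamma> (t i)) (\<gamma> (t (Suc i)))))"
    unfolding sum_distrib_left by (intro ennreal_leI sum_mono) auto
  also have "\<dots> = ennreal K * ennreal (\<Sum>i<m. d (\<gamma> (t i)) (\<gamma> (t (Suc i))))"
    using \<open>0 \<le> K\<close> by (simp add: ennreal_mult sum_nonneg)
  also have "\<dots> \<le> ennreal K * variational_length d a b \<gamma>"
    unfolding variational_length_def using t by (intro mult_left_mono Sup_upper) auto
  finally show "ennreal (\<Sum>i<m. conformal_chord d \<Omega> \<gamma> (t i) (t (Suc i))) \<le> ennreal K * variational_length d a b \<gamma>" .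
qed

text \<open>A path of variational length at most \<open>l\<close> cannot leave the closed ball of radius \<open>l\<close> about
  its starting point.\<close>

lemma dist_on_path_le_variational_length:
  assumes g: "metric_path M d x y a b \<gamma>" and s: "s \<in> {a..b}"
  shows "ennreal (d x (\<gamma> s)) \<le> variational_length d a b \<gamma>"
proof -
  have "ennreal (d x (\<gamma> s)) \<le> ennreal (d x (\<gamma> s) + d (\<gamma> s) y)" by (intro ennreal_leI) simp
  also have "\<dots> \<le> variational_length d a b \<gamma>"
    using two_chords_le_conformal_length[of a s b d \<gamma> "\<lambda>_. 1"] s metric_path_in_space[OF g] metric_path_ends[OF g]
    by (simp add: conformal_chord_def variational_length_eq_conformal_length)
  finally show ?thesis .
qed

lemma Lipschitz_continuous_map:
  assumes "\<And>x y. x \<in> M \<Longrightarrow> y \<in> M \<Longrightarrow> f x \<le> f y + d x y"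
  shows "continuous_map mtopology euclideanreal f"
proof -
  have "dist (f x) (f y) < \<epsilon>" if "x \<in> M" "y \<in> M" "d x y < \<epsilon>" for x y \<epsilon>
    using assms[OF that(1,2)] assms[OF that(2,1)] commute[of y x] that(3)
    unfolding dist_real_def by linarith
  then have "continuous_map mtopology (Metric_space.mtopology UNIV dist) f"
    unfolding metric_continuous_map[OF Met_TC.Metric_space_axioms] by blast
  then show ?thesis by simp
qed

lemma continuous_on_metric_path:
  assumes "metric_path M d x y a b \<gamma>" "continuous_map mtopology euclideanreal f"
  shows "continuous_on {a..b} (\<lambda>s. f (\<gamma> s))"
  using continuous_map_compose[of "top_of_set {a..b}" mtopology \<gamma> euclideanreal f] assms
  by (simp add: metric_path_def o_def)

text \<open>Up to the first time \<open>\<tau>\<close> at distance \<open>\<rho>\<close> from \<open>x\<close>, the path stays in the closed ball where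
  \<open>\<Omega> \<ge> c\<close>, so the partition with the points \<open>a, \<tau>, b\<close> already has a large enough sum.  Nothing
  is assumed about \<open>\<Omega>\<close> where the path goes afterwards, apart from its sign.\<close>

lemma conformal_length_escape:
  assumes g: "metric_path M d x y a b \<gamma>" and pos: "\<And>x. x \<in> M \<Longrightarrow> 0 \<le> \<Omega> x"
    and far: "\<rho> \<le> d x y" and \<rho>: "0 \<le> \<rho>" and c: "0 \<le> c" "\<And>z. z \<in> mcball x \<rho> \<Longrightarrow> c \<le> \<Omega> z"
  shows "ennreal (c * \<rho>) \<le> conformal_length d \<Omega> a b \<gamma>"
proof -
  note e = metric_path_ends[OF g]
  define h where "h s = d x (\<gamma> s)" for s
  have "continuous_map mtopology euclideanreal (d x)"
  proof (rule Lipschitz_continuous_map)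
    show "d x u \<le> d x v + d u v" if "u \<in> M" "v \<in> M" for u v
      using triangle[of x v u] commute[of u v] e that by simp
  qed
  then have h: "continuous_on {a..b} h"
    unfolding h_def by (rule continuous_on_metric_path[OF g])
  define S where "S = {s \<in> {a..b}. \<rho> \<le> h s}"
  have "closed S"
    unfolding S_def by (intro continuous_on_closed_Collect_le continuous_on_const h closed_atLeastAtMost)
  then have "compact ({a..b} \<inter> S)" by (intro compact_Int_closed compact_Icc)
  moreover have "{a..b} \<inter> S = S" by (auto simp: S_def)
  moreover have "b \<in> S" using e far by (auto simp: S_def h_def)
  ultimately obtain \<tau> where \<tau>: "\<tau> \<in> S" "\<And>s. s \<in> S \<Longrightarrow> \<tau> \<le> s"
    using compact_attains_inf[of S] by (metis empty_iff)
  \<comment> \<open>By the intermediate value theorem the first time at distance at least \<open>\<rho>\<close> is at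
    distance exactly \<open>\<rho>\<close>, so that \<open>\<gamma> \<tau>\<close> still lies in the closed ball.\<close>
  have "h a = 0" using e by (simp add: h_def)
  moreover have "continuous_on {a..\<tau>} h" by (rule continuous_on_subset[OF h]) (use \<tau> in \<open>auto simp: S_def\<close>)
  ultimately obtain s where "a \<le> s" "s \<le> \<tau>" "h s = \<rho>"
    using IVT'[of h a \<rho> \<tau>] \<tau> \<rho> by (auto simp: S_def)
  with \<tau> have eq: "h \<tau> = \<rho>" by (force simp: S_def)
  have "h v \<le> \<rho>" if "v \<in> {a..\<tau>}" for v
    using \<tau> that eq by (cases "v = \<tau>") (force simp: S_def)+
  then have "c \<le> (INF v\<in>{a..\<tau>}. \<Omega> (\<gamma> v))"
    using \<tau> metric_path_in_space[OF g] e by (intro cINF_greatest c) (auto simp: S_def h_def)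
  then have "c * \<rho> \<le> conformal_chord d \<Omega> \<gamma> a \<tau>"
    unfolding conformal_chord_def using eq e \<rho> by (intro mult_mono) (auto simp: h_def intro: order_trans[OF c(1)])
  moreover have "0 \<le> conformal_chord d \<Omega> \<gamma> \<tau> b"
    using \<tau> metric_path_in_space[OF g] pos by (intro conformal_chord_nonneg) (auto simp: S_def)
  ultimately have "ennreal (c * \<rho>) \<le> ennreal (conformal_chord d \<Omega> \<gamma> a \<tau> + conformal_chord d \<Omega> \<gamma> \<tau> b)"
    by (intro ennreal_leI) simp
  also have "\<dots> \<le> conformal_length d \<Omega> a b \<gamma>"
    using \<tau> metric_path_in_space[OF g] by (intro two_chords_le_conformal_length) (auto simp: S_def)
  finally show ?thesis .
qed

lemma conformal_dist_escape:
  assumes "\<And>x. x \<in> M \<Longrightarrow> 0 \<le> \<Omega> x"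
    and "\<rho> \<le> d x y" "0 \<le> \<rho>" "0 \<le> c" "\<And>z. z \<in> mcball x \<rho> \<Longrightarrow> c \<le> \<Omega> z"
  shows "ennreal (c * \<rho>) \<le> conformal_dist M d \<Omega> x y"
  unfolding conformal_dist_def
proof (rule Inf_greatest, clarify)
  fix a b \<gamma> assume "metric_path M d x y a b \<gamma>"
  then show "ennreal (c * \<rho>) \<le> conformal_length d \<Omega> a b \<gamma>"
    using assms by (rule conformal_length_escape)
qed

lemma length_space_path:
  assumes "length_space M d" "x \<in> M" "y \<in> M" "d x y < l"
  obtains a b \<gamma> where "metric_path M d x y a b \<gamma>" "variational_length d a b \<gamma> < ennreal l"
proof -
  have "ennreal (d x y) < ennreal l" using assms by (simp add: ennreal_less_iff)
  then have "Inf {variational_length d a b \<gamma> | a b \<gamma>. metric_path M d x y a b \<gamma>} < ennreal l"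
    using assms by (simp add: length_space_def)
  then show ?thesis using that unfolding Inf_less_iff by blast
qed

text \<open>A length space contains a rectifiable path between any two points, because its distances
  are finite; \<open>\<Omega>\<close> is bounded on the compact image of this path.\<close>

lemma conformal_dist_finite:
  assumes "length_space M d" "continuous_map mtopology euclideanreal \<Omega>" "\<And>x. x \<in> M \<Longrightarrow> 0 \<le> \<Omega> x"
    and "x \<in> M" "y \<in> M"
  shows "conformal_dist M d \<Omega> x y < \<infinity>"
proof -
  obtain a b \<gamma> where g: "metric_path M d x y a b \<gamma>" and l: "variational_length d a b \<gamma> < ennreal (d x y + 1)"
    using length_space_path[OF assms(1,4,5), of "d x y + 1"] by auto
  have "compact ((\<lambda>s. \<Omega> (\<gamma> s)) ` {a..b})"
    using continuous_on_metric_path[OF g assms(2)] by (intro compact_continuous_image) auto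
  then have "bdd_above ((\<lambda>s. \<Omega> (\<gamma> s)) ` {a..b})" by (intro bounded_imp_bdd_above compact_imp_bounded)
  then obtain K where K: "\<And>s. s \<in> {a..b} \<Longrightarrow> \<Omega> (\<gamma> s) \<le> K"
    by (meson bdd_above.E imageI)
  have "conformal_dist M d \<Omega> x y \<le> ennreal K * variational_length d a b \<gamma>"
    using conformal_dist_le[OF g] conformal_length_le_variational_length[where \<Omega> = \<Omega>, OF g assms(3) K]
    by (rule order_trans)
  also have "\<dots> < \<infinity>" using order_less_trans[OF l ennreal_less_top]
    by (simp add: ennreal_mult_less_top)
  finally show ?thesis .
qed

text \<open>Since \<open>d x y < l\<close>, a path of variational length below \<open>l\<close> joins \<open>x\<close> and \<open>y\<close>, and it stays in
  the closed ball where \<open>\<Omega> \<le> K\<close>.\<close>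

lemma conformal_dist_local_upper:
  assumes "length_space M d" and pos: "\<And>x. x \<in> M \<Longrightarrow> 0 \<le> \<Omega> x" and "x \<in> M" "y \<in> M"
    and l: "d x y < l" and K: "\<And>z. z \<in> mcball x l \<Longrightarrow> \<Omega> z \<le> K"
  shows "conformal_dist M d \<Omega> x y \<le> ennreal (K * l)"
proof -
  obtain a b \<gamma> where g: "metric_path M d x y a b \<gamma>" and len: "variational_length d a b \<gamma> < ennreal l"
    using length_space_path[OF assms(1,3,4) l] .
  have "0 \<le> l" using l nonneg[of x y] by linarith
  have "0 \<le> K" using K[of x] pos[of x] \<open>x \<in> M\<close> \<open>0 \<le> l\<close> by auto
  have "\<Omega> (\<gamma> s) \<le> K" if "s \<in> {a..b}" for s
  proof -
    have "ennreal (d x (\<gamma> s)) \<le> ennreal l"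
      using dist_on_path_le_variational_length[OF g that] len by simp
    then show ?thesis using K[of "\<gamma> s"] metric_path_in_space[OF g that] \<open>x \<in> M\<close> \<open>0 \<le> l\<close> by (simp add: ennreal_le_iff)
  qed
  then have "conformal_length d \<Omega> a b \<gamma> \<le> ennreal K * variational_length d a b \<gamma>"
    by (intro conformal_length_le_variational_length[OF g]) (auto simp: pos)
  with conformal_dist_le[OF g] have "conformal_dist M d \<Omega> x y \<le> ennreal K * variational_length d a b \<gamma>"
    by (rule order_trans)
  also have "\<dots> \<le> ennreal K * ennreal l" using len by (intro mult_left_mono) auto
  finally show ?thesis using \<open>0 \<le> K\<close> \<open>0 \<le> l\<close> by (simp add: ennreal_mult)
qed

text \<open>The bound \<open>1 \<le> \<Omega>\<close> gives \<open>d x y \<le> d\<^sub>\<Omega> x y\<close>, so that distinct points have positive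
  distance.\<close>

lemma Metric_space_conformal_dist:
  assumes "length_space M d" "continuous_map mtopology euclideanreal \<Omega>"
    and one: "\<And>x. x \<in> M \<Longrightarrow> 1 \<le> \<Omega> x"
  shows "Metric_space M (\<lambda>x y. enn2real (conformal_dist M d \<Omega> x y))"
proof
  have pos: "0 \<le> \<Omega> x" if "x \<in> M" for x using one[OF that] by simp
  have fin: "conformal_dist M d \<Omega> x y < \<infinity>" if "x \<in> M" "y \<in> M" for x y
    by (rule conformal_dist_finite[OF assms(1,2)]) (use pos that in auto)
  show "0 \<le> enn2real (conformal_dist M d \<Omega> x y)" for x y by simp
  show "enn2real (conformal_dist M d \<Omega> x y) = enn2real (conformal_dist M d \<Omega> y x)" for x y
    by (simp add: conformal_dist_commute)
  show "enn2real (conformal_dist M d \<Omega> x y) = 0 \<longleftrightarrow> x = y" if "x \<in> M" "y \<in> M" for x y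
  proof
    assume "enn2real (conformal_dist M d \<Omega> x y) = 0"
    then have "conformal_dist M d \<Omega> x y = 0" using fin[OF that] by (auto simp: enn2real_eq_0_iff)
    moreover have "ennreal (1 * d x y) \<le> conformal_dist M d \<Omega> x y"
      using one pos by (intro conformal_dist_escape) auto
    ultimately have "d x y = 0" using nonneg[of x y] by (simp add: ennreal_eq_0_iff)
    then show "x = y" using that by simp
  next
    assume "x = y"
    have "metric_path M d x x 0 0 (\<lambda>_. x)" using that by (simp add: metric_path_def)
    then have "conformal_dist M d \<Omega> x x \<le> conformal_length d \<Omega> 0 0 (\<lambda>_. x)"
      by (rule conformal_dist_le)
    also have "\<dots> \<le> 0"
      using that by (intro conformal_length_le) (simp add: conformal_chord_def)
    finally have "conformal_dist M d \<Omega> x y \<le> 0" using \<open>x = y\<close> by simp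
    then show "enn2real (conformal_dist M d \<Omega> x y) = 0" by simp
  qed
  show "enn2real (conformal_dist M d \<Omega> x z) \<le> enn2real (conformal_dist M d \<Omega> x y) + enn2real (conformal_dist M d \<Omega> y z)"
    if "x \<in> M" "y \<in> M" "z \<in> M" for x y z
  proof -
    have "enn2real (conformal_dist M d \<Omega> x z) \<le> enn2real (conformal_dist M d \<Omega> x y + conformal_dist M d \<Omega> y z)"
      using conformal_dist_triangle[OF pos] fin that by (intro enn2real_mono) auto
    then show ?thesis using fin that by (simp add: enn2real_plus)
  qed
qed

section \<open>The radius of compactness\<close>

text \<open>The cap at \<open>1\<close> keeps the supremum finite when all closed balls are compact, and makes
  \<open>1 / compact_radius\<close> at least \<open>1\<close>.\<close>

definition compact_radius :: "'a \<Rightarrow> real" where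
  "compact_radius x = Sup {\<rho>. 0 < \<rho> \<and> \<rho> \<le> 1 \<and> compactin mtopology (mcball x \<rho>)}"

lemma compactin_mcball_mono:
  assumes "compactin mtopology (mcball x \<rho>)" "mcball y \<sigma> \<subseteq> mcball x \<rho>"
  shows "compactin mtopology (mcball y \<sigma>)"
  using assms closed_compactin closedin_mcball by blast

lemma compact_radius_ge:
  assumes "0 < \<rho>" "\<rho> \<le> 1" "compactin mtopology (mcball x \<rho>)"
  shows "\<rho> \<le> compact_radius x"
  unfolding compact_radius_def using assms by (intro cSup_upper bdd_aboveI[of _ 1]) auto

lemma compact_radius_bounds:
  assumes "locally_compact_space mtopology" "x \<in> M"
  shows "0 < compact_radius x" "compact_radius x \<le> 1"
    and "\<sigma> < compact_radius x \<Longrightarrow> compactin mtopology (mcball x \<sigma>)"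
proof -
  let ?S = "{\<rho>. 0 < \<rho> \<and> \<rho> \<le> 1 \<and> compactin mtopology (mcball x \<rho>)}"
  obtain U K where UK: "openin mtopology U" "compactin mtopology K" "x \<in> U" "U \<subseteq> K"
    using assms by (auto simp: locally_compact_space_def)
  then obtain r where r: "r > 0" "mball x r \<subseteq> U" by (auto simp: openin_mtopology)
  define \<rho> where "\<rho> = min (r/2) 1"
  have "\<rho> < r" using r by (auto simp: \<rho>_def min_def)
  then have "mcball x \<rho> \<subseteq> K"
    using mcball_subset_mball_concentric[of \<rho> r x] r(2) UK(4) by simp
  then have "compactin mtopology (mcball x \<rho>)" using closed_compactin[OF UK(2)] by auto
  then have S: "\<rho> \<in> ?S" "0 < \<rho>" using r by (auto simp: \<rho>_def)
  then show "0 < compact_radius x" using compact_radius_ge[of \<rho> x] by auto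
  show "compact_radius x \<le> 1" unfolding compact_radius_def using S by (intro cSup_least) auto
  show "compactin mtopology (mcball x \<sigma>)" if "\<sigma> < compact_radius x"
  proof -
    have "\<sigma> < Sup ?S" using that by (simp only: compact_radius_def)
    moreover have "?S \<noteq> {}" using S by blast
    ultimately obtain \<rho>' where "\<rho>' \<in> ?S" "\<sigma> < \<rho>'" by (rule less_cSupE)
    then show ?thesis using compactin_mcball_mono[of x \<rho>' x \<sigma>] mcball_subset_concentric[of \<sigma> \<rho>' x] by simp
  qed
qed

text \<open>If the ball of radius \<open>\<rho>\<close> about \<open>x\<close> is compact, then so is the ball of radius \<open>\<rho> - d x y\<close>
  about \<open>y\<close>, being a closed part of it.  The supremum need not be attained, hence the \<open>e\<close> of room.\<close>

lemma compact_radius_Lipschitz: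
  assumes "locally_compact_space mtopology" "x \<in> M" "y \<in> M"
  shows "compact_radius x \<le> compact_radius y + d x y"
proof (rule field_le_epsilon)
  fix e :: real assume "0 < e"
  show "compact_radius x \<le> compact_radius y + d x y + e"
  proof (cases "compact_radius x - e \<le> d x y")
    case True
    then show ?thesis using compact_radius_bounds(1)[OF assms(1,3)] by simp
  next
    case False
    let ?\<sigma> = "compact_radius x - e - d x y"
    have "compactin mtopology (mcball x (compact_radius x - e))"
      using compact_radius_bounds(3)[OF assms(1,2)] \<open>0 < e\<close> by simp
    moreover have "mcball y ?\<sigma> \<subseteq> mcball x (compact_radius x - e)"
      using assms(2) by (intro mcball_subset) (simp_all add: commute[of y x])
    ultimately have "compactin mtopology (mcball y ?\<sigma>)"
      by (rule compactin_mcball_mono)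
    moreover have "?\<sigma> \<le> 1" using compact_radius_bounds(2)[OF assms(1,2)] nonneg[of x y] \<open>0 < e\<close> by linarith
    ultimately show ?thesis using compact_radius_ge[of ?\<sigma> y] False by simp
  qed
qed

section \<open>Completeness\<close>

text \<open>Points at \<open>d\<^sub>\<Omega>\<close>-distance below \<open>1/3\<close> from \<open>x\<close> lie in the compact ball of half the radius of
  compactness (\<open>near\<close>), and \<open>d\<close>-convergence implies \<open>d\<^sub>\<Omega>\<close>-convergence (\<open>conv\<close>).  So a Cauchy
  sequence for \<open>d\<^sub>\<Omega>\<close> has a convergent subsequence, and hence converges itself.\<close>

lemma mcomplete_inverse_compact_radius:
  assumes len: "length_space M d" and lc: "locally_compact_space mtopology"
  defines "\<Omega> \<equiv> \<lambda>x. inverse (compact_radius x)"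
  assumes metric: "Metric_space M (\<lambda>x y. enn2real (conformal_dist M d \<Omega> x y))"
    and fin: "\<And>x y. x \<in> M \<Longrightarrow> y \<in> M \<Longrightarrow> conformal_dist M d \<Omega> x y < \<infinity>"
  shows "Metric_space.mcomplete M (\<lambda>x y. enn2real (conformal_dist M d \<Omega> x y))"
proof -
  interpret C: Metric_space M "\<lambda>x y. enn2real (conformal_dist M d \<Omega> x y)" by (rule metric)
  note r = compact_radius_bounds[OF lc] and lip = compact_radius_Lipschitz[OF lc]
  have pos: "0 \<le> \<Omega> x" if "x \<in> M" for x using r(1)[OF that] by (simp add: \<Omega>_def)
  have near: "y \<in> mcball x (compact_radius x / 2)"
    if "x \<in> M" "y \<in> M" "enn2real (conformal_dist M d \<Omega> x y) < 1/3" for x y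
  proof (rule ccontr)
    assume "y \<notin> mcball x (compact_radius x / 2)"
    then have far: "compact_radius x / 2 \<le> d x y" using that by auto
    have lower: "inverse (3/2 * compact_radius x) \<le> \<Omega> z" if "z \<in> mcball x (compact_radius x / 2)" for z
    proof -
      have "compact_radius z \<le> 3/2 * compact_radius x"
        using that lip[of z x] by (auto simp: commute)
      then show ?thesis unfolding \<Omega>_def using that r(1)[of z] by (intro le_imp_inverse_le) auto
    qed
    have "ennreal (inverse (3/2 * compact_radius x) * (compact_radius x / 2)) \<le> conformal_dist M d \<Omega> x y"
      using r(1)[OF \<open>x \<in> M\<close>] pos far lower by (intro conformal_dist_escape) auto
    then have "ennreal (1/3) \<le> conformal_dist M d \<Omega> x y"
      using r(1)[OF \<open>x \<in> M\<close>] by simp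
    then have "1/3 \<le> enn2real (conformal_dist M d \<Omega> x y)"
      using enn2real_mono[of "ennreal (1/3)"] fin[OF that(1,2)] by simp
    with that show False by simp
  qed
  have conv: "limitin C.mtopology \<sigma> l sequentially" if "limitin mtopology \<sigma> l sequentially" for \<sigma> l
    unfolding C.limitin_metric
  proof (intro conjI allI impI)
    show l: "l \<in> M" using that limitin_mspace by blast
    fix \<epsilon> :: real assume "0 < \<epsilon>"
    note r0 = r(1)[OF l]
    \<comment> \<open>The second bound makes the resulting estimate \<open>2 / compact_radius l * \<rho>\<close> at most
      \<open>\<epsilon> / 2\<close>.\<close>
    define \<rho> where "\<rho> = min (compact_radius l / 2) (\<epsilon> * compact_radius l / 4)"
    have \<rho>: "0 < \<rho>" "\<rho> \<le> compact_radius l / 2" "\<rho> \<le> \<epsilon> * compact_radius l / 4"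
      using \<open>0 < \<epsilon>\<close> r0 by (auto simp: \<rho>_def)
    \<comment> \<open>Within half the radius of compactness of \<open>l\<close>, the radius at most halves.\<close>
    have K: "\<Omega> z \<le> 2 / compact_radius l" if "z \<in> mcball l \<rho>" for z
    proof -
      have "compact_radius l / 2 \<le> compact_radius z" using that lip[of l z] \<rho> by auto
      then have "inverse (compact_radius z) \<le> inverse (compact_radius l / 2)"
        using r0 by (intro le_imp_inverse_le) auto
      then show ?thesis by (simp add: \<Omega>_def)
    qed
    have close: "enn2real (conformal_dist M d \<Omega> y l) < \<epsilon>" if "y \<in> M" "d y l < \<rho>" for y
    proof -
      have "conformal_dist M d \<Omega> l y \<le> ennreal (2 / compact_radius l * \<rho>)"
        using len pos l that K by (intro conformal_dist_local_upper) (auto simp: commute)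
      then have "enn2real (conformal_dist M d \<Omega> l y) \<le> 2 / compact_radius l * \<rho>"
        using r0 \<rho> by (intro enn2real_leI) auto
      also have "\<dots> \<le> \<epsilon> / 2" using r0 \<rho> by (simp add: field_simps)
      finally show ?thesis using \<open>0 < \<epsilon>\<close> by (simp add: conformal_dist_commute)
    qed
    have "\<forall>\<^sub>F n in sequentially. \<sigma> n \<in> M \<and> d (\<sigma> n) l < \<rho>"
      using that \<rho> by (simp add: limitin_metric)
    then show "\<forall>\<^sub>F n in sequentially. \<sigma> n \<in> M \<and> enn2real (conformal_dist M d \<Omega> (\<sigma> n) l) < \<epsilon>"
      by (rule eventually_mono) (use close in auto)
  qed
  show ?thesis
    unfolding C.mcomplete_def
  proof (intro allI impI)
    fix \<sigma> assume \<sigma>: "C.MCauchy \<sigma>"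
    then have M: "\<sigma> n \<in> M" for n by (auto simp: C.MCauchy_def)
    obtain N where N: "\<And>n n'. N \<le> n \<Longrightarrow> N \<le> n' \<Longrightarrow> enn2real (conformal_dist M d \<Omega> (\<sigma> n) (\<sigma> n')) < 1/3"
      using \<sigma> unfolding C.MCauchy_def by (meson zero_less_divide_1_iff zero_less_numeral)
    let ?B = "mcball (\<sigma> N) (compact_radius (\<sigma> N) / 2)"
    have "compactin mtopology ?B" using r(1,3)[OF M] by simp
    moreover have "range (\<sigma> \<circ> (+) N) \<subseteq> ?B" using near[OF M M N] M by auto
    ultimately obtain l k where k: "strict_mono k" "limitin mtopology ((\<sigma> \<circ> (+) N) \<circ> k) l sequentially"
      unfolding compactin_sequentially by blast
    have "strict_mono ((+) N \<circ> k)" using k(1) by (simp add: strict_mono_def)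
    moreover have "limitin C.mtopology (\<sigma> \<circ> ((+) N \<circ> k)) l sequentially"
      using conv[OF k(2)] by (simp add: o_assoc)
    ultimately show "\<exists>x. limitin C.mtopology \<sigma> x sequentially"
      using C.MCauchy_convergent_subsequence[OF \<sigma>] by blast
  qed
qed

end

theorem theorem5p18:
  fixes M :: "'a set" and d :: "'a \<Rightarrow> 'a \<Rightarrow> real"
  assumes "Metric_space M d"
    and "length_space M d"
    and "locally_compact_space (Metric_space.mtopology M d)"
  shows "\<exists>\<Omega> :: 'a \<Rightarrow> real.
           continuous_map (Metric_space.mtopology M d) euclideanreal \<Omega> \<and>
           (\<forall>x\<in>M. 0 < \<Omega> x) \<and>
           (\<forall>x\<in>M. \<forall>y\<in>M. conformal_dist M d \<Omega> x y < \<infinity>) \<and>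
           Metric_space M (\<lambda>x y. enn2real (conformal_dist M d \<Omega> x y)) \<and>
           Metric_space.mcomplete M (\<lambda>x y. enn2real (conformal_dist M d \<Omega> x y))"
proof -
  interpret Metric_space M d by (rule assms(1))
  define \<Omega> where "\<Omega> = (\<lambda>x. inverse (compact_radius x))"
  note r = compact_radius_bounds[OF assms(3)]
  have cont: "continuous_map mtopology euclideanreal \<Omega>"
    unfolding \<Omega>_def
  proof (rule continuous_map_real_inverse)
    show "continuous_map mtopology euclideanreal compact_radius"
      by (rule Lipschitz_continuous_map[OF compact_radius_Lipschitz[OF assms(3)]])
    show "compact_radius x \<noteq> 0" if "x \<in> topspace mtopology" for x
      using r(1)[of x] that by simp
  qed
  have one: "1 \<le> \<Omega> x" if "x \<in> M" for x using r(1,2)[OF that] by (simp add: \<Omega>_def one_le_inverse)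
  have pos: "0 < \<Omega> x" if "x \<in> M" for x using one[OF that] by simp
  have fin: "conformal_dist M d \<Omega> x y < \<infinity>" if "x \<in> M" "y \<in> M" for x y
    using conformal_dist_finite[OF assms(2) cont _ that] pos less_imp_le by blast
  have metric: "Metric_space M (\<lambda>x y. enn2real (conformal_dist M d \<Omega> x y))"
    by (rule Metric_space_conformal_dist[OF assms(2) cont one])
  have "Metric_space.mcomplete M (\<lambda>x y. enn2real (conformal_dist M d \<Omega> x y))"
    unfolding \<Omega>_def using assms(2,3) metric fin unfolding \<Omega>_def by (rule mcomplete_inverse_compact_radius)
  then show ?thesis using cont pos fin metric by blast
qed

end
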